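(* Let $m,n\ge 1$ be integers and let $CF(m,n)$ be the Farey complex of order $(m,n)$. Then the closure of every connected component of $CF(m,n)$ is a triangle or a quadrilateral (that is, a convex polygon with non-empty interior having exactly 3 or exactly 4 sides).
   Context: For integers $m,n\ge 1$, $D_{m,n}$ is the set of lines in $\mathbb{R}^2$ that meet the unit square $CU=[0,1]^2$ and admit an equation $ux+vy-w=0$ with $u,v,w\in\mathbb{Z}$, $-m\le u\le m$, $-n\le v\le n$, $(u,v)\ne(0,0)$. This set is finite. The Farey complex $CF(m,n)$ is the complement in $CU$ of the union of all lines of $D_{m,n}$. A convex polygon is a bounded subset of the plane with non-empty interior that is a finite intersection of closed half-planes; its number of sides is the minimal number of closed half-planes needed in such an intersection. *)

theory Defs
  imports "HOL-Analysis.Analysis"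
begin

definition unit_square :: "(real \<times> real) set" where
  "unit_square = {0..1} \<times> {0..1}"

definition int_line :: "int \<Rightarrow> int \<Rightarrow> int \<Rightarrow> (real \<times> real) set" where
  "int_line u v w = {(x, y). of_int u * x + of_int v * y - of_int w = 0}"

(* A set of lines, each line being its set of points; w is unbounded, but only
   finitely many values of w give a line that meets the square. *)
definition farey_lines :: "int \<Rightarrow> int \<Rightarrow> (real \<times> real) set set" where
  "farey_lines m n =
     {L. L \<inter> unit_square \<noteq> {} \<and>
         (\<exists>u v w. - m \<le> u \<and> u \<le> m \<and> - n \<le> v \<and> v \<le> n \<and> (u, v) \<noteq> (0, 0) \<and>
                  L = int_line u v w)}"

definition farey_complex :: "int \<Rightarrow> int \<Rightarrow> (real \<times> real) set" where
  "farey_complex m n = unit_square - \<Union> (farey_lines m n)"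

definition closed_halfplane :: "(real \<times> real) set \<Rightarrow> bool" where
  "closed_halfplane H \<longleftrightarrow> (\<exists>a b. a \<noteq> 0 \<and> H = {p. a \<bullet> p \<le> b})"

(* In this dimension, polyhedron says exactly that P is the intersection of
   finitely many sets satisfying closed_halfplane. *)
definition convex_polygon :: "(real \<times> real) set \<Rightarrow> bool" where
  "convex_polygon P \<longleftrightarrow> bounded P \<and> interior P \<noteq> {} \<and> polyhedron P"

(* Meaningful only when P is a finite intersection of closed half-planes, so
   that the set of cardinalities is non-empty. *)
definition num_sides :: "(real \<times> real) set \<Rightarrow> nat" where
  "num_sides P =
     (LEAST k. \<exists>F. finite F \<and> card F = k \<and> (\<forall>H\<in>F. closed_halfplane H) \<and> P = \<Inter> F)"

definition is_triangle :: "(real \<times> real) set \<Rightarrow> bool" where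
  "is_triangle P \<longleftrightarrow> convex_polygon P \<and> num_sides P = 3"

definition is_quadrilateral :: "(real \<times> real) set \<Rightarrow> bool" where
  "is_quadrilateral P \<longleftrightarrow> convex_polygon P \<and> num_sides P = 4"

end

(* A cell is cut out by inequalities a . p <= w, one for each integer vector a in the box
   B = [-m,m] x [-n,n], where w is the least integer exceeding a . p on the cell.  If two
   inequalities a, b of an irredundant subsystem had a - b in B, then the difference of their
   slacks would have opposite strict signs on the two corresponding edges, so a line of the
   arrangement would cut the cell.  Two vectors of B in the same quadrant differ by a vector
   of B, so there is at most one edge for each quadrant. *)
theory Submission
  imports Defs
begin

section \<open>Integer normals and membership in the Farey complex\<close>

definition real_vec :: "int \<times> int \<Rightarrow> real \<times> real" where
  "real_vec a = (of_int (fst a), of_int (snd a))"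

definition farey_normals :: "int \<Rightarrow> int \<Rightarrow> (int \<times> int) set" where
  "farey_normals m n = {- m..m} \<times> {- n..n} - {(0, 0)}"

lemma real_vec_diff: "real_vec (a - b) = real_vec a - real_vec b"
  by (simp add: real_vec_def)

lemma real_vec_uminus: "real_vec (- a) = - real_vec a"
  by (simp add: real_vec_def)

lemma real_vec_eq_0: "real_vec a = 0 \<longleftrightarrow> a = (0, 0)"
  by (cases a) (simp add: real_vec_def zero_prod_def)

lemma finite_farey_normals: "finite (farey_normals m n)"
  by (simp add: farey_normals_def)

lemma farey_normals_uminus: "a \<in> farey_normals m n \<Longrightarrow> - a \<in> farey_normals m n"
  by (cases a) (auto simp: farey_normals_def)

lemma int_line_iff: "p \<in> int_line (fst a) (snd a) w \<longleftrightarrow> real_vec a \<bullet> p = of_int w"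
  by (cases p) (auto simp: int_line_def real_vec_def)

lemma no_int_between:
  "\<not> (real_of_int k - 1 < of_int w \<and> real_of_int w < of_int k)"
proof
  assume "real_of_int k - 1 < of_int w \<and> real_of_int w < of_int k"
  then have "real_of_int (k - 1) < of_int w" "real_of_int w < of_int k"
    by simp_all
  then have "k - 1 < w" "w < k"
    unfolding of_int_less_iff .
  then show False by simp
qed

text \<open>The offset of a line is an arbitrary integer, so avoiding every line with normal
  \<open>a\<close> means that the inner product with \<open>a\<close> is not an integer. The lines
  are also required to meet the square, but a line through a point \<open>p\<close> of the square
  does so at \<open>p\<close>.\<close>

lemma farey_complex_iff:
  "p \<in> farey_complex m n \<longleftrightarrow>
     p \<in> unit_square \<and> (\<forall>a \<in> farey_normals m n. real_vec a \<bullet> p \<notin> \<int>)"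
proof
  assume p: "p \<in> farey_complex m n"
  have "real_vec a \<bullet> p \<notin> \<int>" if a: "a \<in> farey_normals m n" for a
  proof
    assume "real_vec a \<bullet> p \<in> \<int>"
    then obtain w where "real_vec a \<bullet> p = of_int w"
      by (auto elim: Ints_cases)
    then have "p \<in> int_line (fst a) (snd a) w"
      by (simp add: int_line_iff)
    moreover have "int_line (fst a) (snd a) w \<in> farey_lines m n"
    proof -
      have "int_line (fst a) (snd a) w \<inter> unit_square \<noteq> {}"
        using p \<open>p \<in> int_line (fst a) (snd a) w\<close> by (auto simp: farey_complex_def)
      then show ?thesis
        using a unfolding farey_lines_def farey_normals_def
        by (cases a) force
    qed
    ultimately show False
      using p by (auto simp: farey_complex_def)
  qed
  then show "p \<in> unit_square \<and> (\<forall>a \<in> farey_normals m n. real_vec a \<bullet> p \<notin> \<int>)"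
    using p by (auto simp: farey_complex_def)
next
  assume p: "p \<in> unit_square \<and> (\<forall>a \<in> farey_normals m n. real_vec a \<bullet> p \<notin> \<int>)"
  have "p \<notin> L" if "L \<in> farey_lines m n" for L
  proof -
    obtain u v w where uvw: "(u, v) \<in> farey_normals m n" "L = int_line u v w"
      using \<open>L \<in> farey_lines m n\<close> by (auto simp: farey_lines_def farey_normals_def)
    then show ?thesis
      using p int_line_iff[of p "(u, v)" w] by fastforce
  qed
  then show "p \<in> farey_complex m n"
    using p by (auto simp: farey_complex_def)
qed

section \<open>General facts on finite systems of linear inequalities\<close>

text \<open>At most two half-planes of the plane share a direction \<open>d\<close> along which none
  of them is ever left, so a nonempty intersection contains a ray and is unbounded.\<close>

lemma bounded_imp_3_le_card_halfplanes:
  assumes F: "finite F" "\<forall>H\<in>F. closed_halfplane H"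
    and P: "bounded (\<Inter>F)" "\<Inter>F \<noteq> {}"
  shows "3 \<le> card F"
proof (rule ccontr)
  assume "\<not> 3 \<le> card F"
  then have "card F \<le> 2" by simp
  have halfplane: "\<exists>a b. H = {p. a \<bullet> p \<le> b}" if "H \<in> F" for H
    using F(2) that unfolding closed_halfplane_def by metis
  \<comment> \<open>\<open>A\<close> and \<open>B\<close> may coincide, which treats families of one
    and of two members together.\<close>
  obtain A B where AB: "F \<subseteq> {A, B}" "A \<in> F" "B \<in> F" if "F \<noteq> {}"
  proof -
    have "card F = 1 \<or> card F = 2" if "F \<noteq> {}"
      using \<open>card F \<le> 2\<close> F(1) that card_gt_0_iff[of F] by linarith
    then show thesis
      using that by (metis card_1_singletonE card_2_iff insertI1 insert_absorb2 insert_commute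
          order_refl)
  qed
  have "\<exists>d. d \<noteq> 0 \<and> (\<forall>H\<in>F. \<forall>p\<in>H. \<forall>t\<ge>0. p + t *\<^sub>R d \<in> H)"
  proof (cases "F = {}")
    case True
    have "(1, 0) \<noteq> (0 :: real \<times> real)" by (simp add: zero_prod_def)
    with True show ?thesis by blast
  next
    case False
    obtain a b where A: "A = {p. a \<bullet> p \<le> b}" using halfplane AB(2) False by blast
    obtain a' b' where B: "B = {p. a' \<bullet> p \<le> b'}" using halfplane AB(3) False by blast
    obtain e where e: "e \<noteq> 0" "a \<bullet> e = 0"
    proof (cases "a = 0")
      case True
      then show thesis using that[of "(1, 0)"] by (simp add: zero_prod_def)
    next
      case False
      then show thesis
        using that[of "(- snd a, fst a)"] by (auto simp: inner_prod_def prod_eq_iff)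
    qed
    \<comment> \<open>Both \<open>e\<close> and \<open>- e\<close> run parallel to the boundary of
      \<open>A\<close>; the sign is chosen so that \<open>B\<close> is not left either.\<close>
    define d where "d = (if a' \<bullet> e \<le> 0 then e else - e)"
    have d: "d \<noteq> 0" "a \<bullet> d \<le> 0" "a' \<bullet> d \<le> 0"
      using e by (auto simp: d_def)
    have "c \<bullet> p + t * (c \<bullet> d) \<le> r" if "c \<bullet> p \<le> r" "c \<bullet> d \<le> 0" "0 \<le> t" for c p t r
      using that mult_nonneg_nonpos[of t "c \<bullet> d"] by linarith
    then have "\<forall>H\<in>{A, B}. \<forall>p\<in>H. \<forall>t\<ge>0. p + t *\<^sub>R d \<in> H"
      using d unfolding A B by (auto simp: inner_add_right)
    then show ?thesis using d(1) AB(1)[OF False] by blast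
  qed
  then obtain d where d: "d \<noteq> 0" "\<And>H p t. H \<in> F \<Longrightarrow> p \<in> H \<Longrightarrow> 0 \<le> t \<Longrightarrow> p + t *\<^sub>R d \<in> H"
    by blast
  obtain p where "p \<in> \<Inter>F" using P(2) by blast
  then have ray: "p + t *\<^sub>R d \<in> \<Inter>F" if "0 \<le> t" for t
    using d(2) that by blast
  obtain M where M: "\<And>q. q \<in> \<Inter>F \<Longrightarrow> norm q \<le> M"
    using P(1) unfolding bounded_iff by metis
  \<comment> \<open>Moving from \<open>p\<close> by a vector of length \<open>M + norm p + 1\<close>
    leaves the ball of radius \<open>M\<close>, by the triangle inequality.\<close>
  define t where "t = (M + norm p + 1) / norm d"
  have "0 \<le> M" using M[OF \<open>p \<in> \<Inter>F\<close>] norm_ge_zero[of p] by linarith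
  then have t: "0 \<le> t" "norm (t *\<^sub>R d) = M + norm p + 1"
    using d(1) by (simp_all add: t_def)
  have "norm (t *\<^sub>R d) \<le> norm (p + t *\<^sub>R d) + norm p"
    by (metis add_diff_cancel_left' norm_triangle_ineq4)
  then show False using M[OF ray[OF t(1)]] t(2) by linarith
qed

text \<open>Take an index set of least cardinality among those with the same intersection: an index
  whose set contains the intersection of the others could be dropped.\<close>

lemma obtain_irredundant_subfamily:
  assumes "finite N"
  obtains T where "T \<subseteq> N" "(\<Inter>a\<in>T. H a) = (\<Inter>a\<in>N. H a)"
    "\<And>a. a \<in> T \<Longrightarrow> \<not> (\<Inter>b\<in>T - {a}. H b) \<subseteq> H a"
proof -
  define Q where "Q T \<longleftrightarrow> T \<subseteq> N \<and> (\<Inter>a\<in>T. H a) = (\<Inter>a\<in>N. H a)" for T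
  have "Q N" by (simp add: Q_def)
  then obtain T where T: "Q T" "\<And>S. Q S \<Longrightarrow> card T \<le> card S"
    using ex_has_least_nat[of Q N card] by blast
  have "\<not> (\<Inter>b\<in>T - {a}. H b) \<subseteq> H a" if "a \<in> T" for a
  proof
    assume "(\<Inter>b\<in>T - {a}. H b) \<subseteq> H a"
    then have "(\<Inter>b\<in>T - {a}. H b) = (\<Inter>b\<in>T. H b)"
      using that by blast
    then have "Q (T - {a})" using T(1) by (auto simp: Q_def)
    moreover have "card (T - {a}) < card T"
      using T(1) that assms by (meson Q_def card_Diff1_less finite_subset)
    ultimately show False using T(2) by fastforce
  qed
  then show thesis using that T(1) by (auto simp: Q_def)
qed

text \<open>Irredundancy yields a point \<open>r\<close> that violates inequality \<open>a\<close>
  alone, while \<open>q\<close> satisfies all of them strictly. The segment from \<open>q\<close> to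
  \<open>r\<close> meets the boundary of \<open>a\<close> before reaching \<open>r\<close>, and
  there the positive weight of \<open>q\<close> keeps the other inequalities strict.\<close>

lemma irredundant_inequality_tight:
  fixes g :: "'i \<Rightarrow> 'v::real_inner" and c :: "'i \<Rightarrow> real"
  assumes "\<not> (\<Inter>b\<in>T - {a}. {p. g b \<bullet> p \<le> c b}) \<subseteq> {p. g a \<bullet> p \<le> c a}"
    and q: "\<And>b. b \<in> T \<Longrightarrow> g b \<bullet> q < c b" and "a \<in> T"
  obtains p where "g a \<bullet> p = c a" "\<And>b. b \<in> T - {a} \<Longrightarrow> g b \<bullet> p < c b"
proof -
  obtain r where r: "\<And>b. b \<in> T - {a} \<Longrightarrow> g b \<bullet> r \<le> c b" "c a < g a \<bullet> r"
    using assms(1) by fastforce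
  \<comment> \<open>This is the parameter at which the affine function \<open>g a\<close> takes the
    value \<open>c a\<close> on the segment from \<open>q\<close> to \<open>r\<close>.\<close>
  define s where "s = (c a - g a \<bullet> q) / (g a \<bullet> r - g a \<bullet> q)"
  have qa: "g a \<bullet> q < c a" using q assms(3) by blast
  have s: "0 < s" "s < 1" using r(2) qa by (auto simp: s_def field_simps)
  define p where "p = (1 - s) *\<^sub>R q + s *\<^sub>R r"
  have ip: "g b \<bullet> p = (1 - s) * (g b \<bullet> q) + s * (g b \<bullet> r)" for b
    by (simp add: p_def inner_add_right)
  have "s * (g a \<bullet> r - g a \<bullet> q) = c a - g a \<bullet> q"
    using r(2) qa by (simp add: s_def)
  then have "g a \<bullet> p = c a" unfolding ip by algebra
  moreover have "g b \<bullet> p < c b" if "b \<in> T - {a}" for b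
  proof -
    have "(1 - s) * (g b \<bullet> q) < (1 - s) * c b" using q[of b] s that by simp
    moreover have "s * (g b \<bullet> r) \<le> s * c b" using r(1)[OF that] s by simp
    ultimately show ?thesis unfolding ip by (simp add: algebra_simps)
  qed
  ultimately show thesis using that by blast
qed

section \<open>A component as an open convex cell around a base point\<close>

locale farey_cell =
  fixes m n :: int and C :: "(real \<times> real) set" and p0 :: "real \<times> real"
  assumes m: "1 \<le> m" and n: "1 \<le> n"
    and C: "C \<in> components (farey_complex m n)" and p0: "p0 \<in> C"
begin

text \<open>Floor plus one exceeds the value at \<open>p0\<close> by construction. For a normal in
  the box that value is not an integer, so the bound is then also its ceiling.\<close>

definition bound :: "int \<times> int \<Rightarrow> int" where
  "bound a = \<lfloor>real_vec a \<bullet> p0\<rfloor> + 1"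

text \<open>Upper bounds suffice because the box of normals is symmetric: a lower bound for
  \<open>a\<close> is an upper bound for \<open>- a\<close>.\<close>

definition cell :: "(real \<times> real) set" where
  "cell = {p. \<forall>a\<in>farey_normals m n. real_vec a \<bullet> p < of_int (bound a)}"

definition halfplane :: "int \<times> int \<Rightarrow> (real \<times> real) set" where
  "halfplane a = {p. real_vec a \<bullet> p \<le> of_int (bound a)}"

lemma C_subset: "C \<subseteq> farey_complex m n"
  using C in_components_subset by blast

lemma normal_not_int:
  assumes "p \<in> C" "a \<in> farey_normals m n"
  shows "real_vec a \<bullet> p \<noteq> of_int w"
  using assms C_subset farey_complex_iff by (metis Ints_of_int subsetD)

lemma p0_in_cell: "p0 \<in> cell"
  unfolding cell_def bound_def by (simp add: floor_less_iff)

text \<open>The value at \<open>p0\<close> is not an integer, so negation sends its floor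
  \<open>k\<close> to \<open>- k - 1\<close>. Hence the inequalities for \<open>a\<close> and
  \<open>- a\<close> cut out a strip between consecutive integer levels.\<close>

lemma bound_uminus:
  assumes "a \<in> farey_normals m n"
  shows "bound (- a) = 1 - bound a"
proof -
  have "real_vec a \<bullet> p0 \<noteq> of_int \<lfloor>real_vec a \<bullet> p0\<rfloor>"
    using normal_not_int[OF p0 assms] .
  then have "\<lfloor>- (real_vec a \<bullet> p0)\<rfloor> = - \<lfloor>real_vec a \<bullet> p0\<rfloor> - 1"
    by linarith
  then show ?thesis by (simp add: bound_def real_vec_uminus)
qed

lemma cell_bounds:
  assumes "p \<in> cell" "a \<in> farey_normals m n"
  shows "of_int (bound a) - 1 < real_vec a \<bullet> p" "real_vec a \<bullet> p < of_int (bound a)"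
proof -
  show "real_vec a \<bullet> p < of_int (bound a)" using assms by (simp add: cell_def)
  have "real_vec (- a) \<bullet> p < of_int (bound (- a))"
    using assms farey_normals_uminus by (auto simp: cell_def)
  then show "of_int (bound a) - 1 < real_vec a \<bullet> p"
    using bound_uminus[OF assms(2)] by (simp add: real_vec_uminus)
qed

lemma unit_normals: "(1, 0) \<in> farey_normals m n" "(0, 1) \<in> farey_normals m n"
  using m n by (auto simp: farey_normals_def)

text \<open>The square is itself a strip condition: the unit vectors are among the normals, and
  their strips around \<open>p0\<close> are those between 0 and 1.\<close>

lemma cell_subset_unit_square: "cell \<subseteq> unit_square"
proof
  fix p assume p: "p \<in> cell"
  have p0_sq: "p0 \<in> unit_square" using p0 C_subset by (auto simp: farey_complex_def)
  have coord: "real_vec (1, 0) \<bullet> q = fst q" "real_vec (0, 1) \<bullet> q = snd q" for q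
    by (simp_all add: real_vec_def inner_prod_def)
  \<comment> \<open>A coordinate equal to 1 would have floor 1 and select the strip just outside the
    square.\<close>
  have "fst p0 \<noteq> 1" "snd p0 \<noteq> 1"
    using normal_not_int[OF p0, of _ 1] unit_normals coord of_int_1 by metis+
  moreover have "0 \<le> fst p0" "fst p0 \<le> 1" "0 \<le> snd p0" "snd p0 \<le> 1"
    using p0_sq by (auto simp: unit_square_def)
  ultimately have "\<lfloor>fst p0\<rfloor> = 0" "\<lfloor>snd p0\<rfloor> = 0"
    by linarith+
  then have "bound (1, 0) = 1" "bound (0, 1) = 1"
    unfolding bound_def coord by simp_all
  then have "0 < fst p" "fst p < 1" "0 < snd p" "snd p < 1"
    using cell_bounds[OF p unit_normals(1)] cell_bounds[OF p unit_normals(2)]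
    unfolding coord by simp_all
  then show "p \<in> unit_square"
    by (cases p) (simp add: unit_square_def)
qed

lemma cell_eq_Inter: "cell = (\<Inter>a\<in>farey_normals m n. {p. real_vec a \<bullet> p < of_int (bound a)})"
  by (auto simp: cell_def)

lemma convex_cell: "convex cell"
  unfolding cell_eq_Inter by (intro convex_INT convex_halfspace_lt)

lemma open_cell: "open cell"
  unfolding cell_eq_Inter
  by (intro open_INT finite_farey_normals ballI open_halfspace_lt)

text \<open>The cell is convex, avoids all lines and contains \<open>p0\<close>, so maximality of
  the component puts it inside \<open>C\<close>. Conversely, if the connected set \<open>C\<close>
  left the cell, it would meet a line at some level \<open>bound a\<close> by the intermediate value
  property.\<close>

lemma C_eq_cell: "C = cell"
proof
  have "cell \<subseteq> farey_complex m n"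
  proof
    fix p assume p: "p \<in> cell"
    have "real_vec a \<bullet> p \<notin> \<int>" if "a \<in> farey_normals m n" for a
    proof
      assume "real_vec a \<bullet> p \<in> \<int>"
      then obtain w where "real_vec a \<bullet> p = of_int w" by (auto elim: Ints_cases)
      then show False using cell_bounds[OF p that] no_int_between by metis
    qed
    then show "p \<in> farey_complex m n"
      using p cell_subset_unit_square farey_complex_iff by blast
  qed
  then show "cell \<subseteq> C"
    using components_maximal[OF C convex_connected[OF convex_cell]] p0 p0_in_cell by blast
  show "C \<subseteq> cell"
  proof
    fix p assume p: "p \<in> C"
    have "real_vec a \<bullet> p < of_int (bound a)" if a: "a \<in> farey_normals m n" for a
    proof (rule ccontr)
      assume "\<not> real_vec a \<bullet> p < of_int (bound a)"
      moreover have "real_vec a \<bullet> p0 < of_int (bound a)"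
        using cell_bounds(2)[OF p0_in_cell a] .
      moreover have "connected C" using C in_components_connected by blast
      ultimately obtain q where "q \<in> C" "real_vec a \<bullet> q = of_int (bound a)"
        using connected_ivt_hyperplane[of C p0 p "real_vec a" "of_int (bound a)"] p0 p by force
      then show False using normal_not_int a by blast
    qed
    then show "p \<in> cell" by (simp add: cell_def)
  qed
qed

text \<open>Relaxing strict inequalities gives the closure because \<open>p0\<close> satisfies all
  of them strictly: from any point of the closed system, the open segment to \<open>p0\<close> stays
  in the cell.\<close>

lemma closure_C: "closure C = (\<Inter>a\<in>farey_normals m n. halfplane a)"
proof
  have "closed (\<Inter>a\<in>farey_normals m n. halfplane a)"
    unfolding halfplane_def by (intro closed_INT ballI closed_halfspace_le)
  moreover have "C \<subseteq> (\<Inter>a\<in>farey_normals m n. halfplane a)"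
    unfolding C_eq_cell by (force simp: cell_def halfplane_def)
  ultimately show "closure C \<subseteq> (\<Inter>a\<in>farey_normals m n. halfplane a)"
    by (rule closure_minimal[rotated])
  show "(\<Inter>a\<in>farey_normals m n. halfplane a) \<subseteq> closure C"
  proof
    fix p assume p: "p \<in> (\<Inter>a\<in>farey_normals m n. halfplane a)"
    show "p \<in> closure C"
    \<comment> \<open>For \<open>p = p0\<close> the open segment is empty and its closure does not
      contain \<open>p\<close>.\<close>
    proof (cases "p = p0")
      case True
      then show ?thesis using p0 closure_subset by blast
    next
      case False
      have "open_segment p p0 \<subseteq> cell"
      proof
        fix q assume "q \<in> open_segment p p0"
        then obtain s where s: "0 < s" "s < 1" "q = (1 - s) *\<^sub>R p + s *\<^sub>R p0"
          by (auto simp: in_segment)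
        have "real_vec a \<bullet> q < of_int (bound a)" if a: "a \<in> farey_normals m n" for a
        proof -
          have "(1 - s) * (real_vec a \<bullet> p) \<le> (1 - s) * of_int (bound a)"
            using p a s(2) by (auto simp: halfplane_def)
          moreover have "s * (real_vec a \<bullet> p0) < s * of_int (bound a)"
            using cell_bounds(2)[OF p0_in_cell a] s(1) by simp
          ultimately show ?thesis
            by (simp add: s(3) inner_add_right algebra_simps)
        qed
        then show "q \<in> cell" by (simp add: cell_def)
      qed
      then have "closed_segment p p0 \<subseteq> closure C"
        using closure_mono closure_open_segment[of p p0] False C_eq_cell by metis
      then show ?thesis by auto
    qed
  qed
qed

section \<open>Counting the sides of the closure\<close>

lemma closed_halfplane_halfplane: "a \<in> farey_normals m n \<Longrightarrow> closed_halfplane (halfplane a)"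
  unfolding closed_halfplane_def halfplane_def
  using real_vec_eq_0[of a] unfolding farey_normals_def by blast

text \<open>Strict inequalities are open conditions, so they would already hold at points of
  \<open>C\<close>, whose values under \<open>a\<close> all lie between two consecutive
  integers.\<close>

lemma normal_sign_on_closure:
  assumes a: "a \<in> farey_normals m n" and "p \<in> closure C" "p' \<in> closure C"
    and "real_vec a \<bullet> p < of_int w" "of_int w < real_vec a \<bullet> p'"
  shows False
proof -
  have near: "\<exists>q\<in>C. q \<in> U" if "open U" "x \<in> U" "x \<in> closure C" for x U
    using that by (auto simp: closure_iff_nhds_not_empty)
  obtain q where q: "q \<in> C" "real_vec a \<bullet> q < of_int w"
    using near[OF open_halfspace_lt, of p] assms(2,4) by blast
  obtain q' where q': "q' \<in> C" "of_int w < real_vec a \<bullet> q'"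
    using near[OF open_halfspace_gt, of p'] assms(3,5) by blast
  have "of_int (bound a) - 1 < real_vec a \<bullet> q" "real_vec a \<bullet> q' < of_int (bound a)"
    using cell_bounds q(1) q'(1) a C_eq_cell by blast+
  then show False
    using no_int_between[of "bound a" w] q(2) q'(2) by linarith
qed

text \<open>An upper bound is all that is sought here, since \<open>num_sides\<close> is a minimum;
  the bound from below comes from boundedness.\<close>

lemma at_most_4_halfplanes:
  "\<exists>F. finite F \<and> card F \<le> 4 \<and> (\<forall>H\<in>F. closed_halfplane H) \<and> closure C = \<Inter>F"
proof -
  obtain T where T: "T \<subseteq> farey_normals m n"
    and T_eq: "(\<Inter>a\<in>T. halfplane a) = (\<Inter>a\<in>farey_normals m n. halfplane a)"
    and irr: "\<And>a. a \<in> T \<Longrightarrow> \<not> (\<Inter>b\<in>T - {a}. halfplane b) \<subseteq> halfplane a"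
    using obtain_irredundant_subfamily[OF finite_farey_normals] by metis
  have closure_C_eq: "closure C = (\<Inter>a\<in>T. halfplane a)"
    using T_eq closure_C by simp
  have finT: "finite T" using T finite_farey_normals finite_subset by blast
  \<comment> \<open>The witness is a point in the relative interior of the edge of \<open>a\<close>:
    no other inequality of \<open>T\<close> is tight there.\<close>
  have edge: "\<exists>p\<in>closure C. real_vec a \<bullet> p = of_int (bound a) \<and>
      (\<forall>b\<in>T - {a}. real_vec b \<bullet> p < of_int (bound b))" if a: "a \<in> T" for a
  proof -
    obtain p where p: "real_vec a \<bullet> p = of_int (bound a)"
      "\<And>b. b \<in> T - {a} \<Longrightarrow> real_vec b \<bullet> p < of_int (bound b)"
      using irredundant_inequality_tight[OF irr[OF a, unfolded halfplane_def] _ a, of p0]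
        cell_bounds(2)[OF p0_in_cell] T by blast
    then have "p \<in> closure C"
      unfolding closure_C_eq halfplane_def by force
    then show ?thesis using p by (intro bexI[of _ p] conjI ballI)
  qed
  \<comment> \<open>Zero counts as nonnegative, so every vector lies in exactly one of four classes,
    and within a class coordinates differ by no more than the larger absolute value.\<close>
  define quadrant where "quadrant = (\<lambda>a :: int \<times> int. (0 \<le> fst a, 0 \<le> snd a))"
  have "inj_on quadrant T"
  proof (rule inj_onI, rule ccontr)
    fix a b assume ab: "a \<in> T" "b \<in> T" "quadrant a = quadrant b" "a \<noteq> b"
    have "\<bar>i - j\<bar> \<le> k" if "(0 \<le> i) = (0 \<le> j)" "\<bar>i\<bar> \<le> k" "\<bar>j\<bar> \<le> k" for i j k :: int
      using that by linarith
    from this[of "fst a" "fst b" m] this[of "snd a" "snd b" n]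
    have "\<bar>fst (a - b)\<bar> \<le> m" "\<bar>snd (a - b)\<bar> \<le> n"
      using ab(1-3) T unfolding quadrant_def farey_normals_def by fastforce+
    then have "a - b \<in> farey_normals m n"
      using ab(4) unfolding farey_normals_def by (cases a; cases b) auto
    moreover obtain p where "p \<in> closure C" "real_vec a \<bullet> p = of_int (bound a)"
      "real_vec b \<bullet> p < of_int (bound b)"
      using edge[OF ab(1)] ab by blast
    moreover obtain p' where "p' \<in> closure C" "real_vec b \<bullet> p' = of_int (bound b)"
      "real_vec a \<bullet> p' < of_int (bound a)"
      using edge[OF ab(2)] ab by blast
    \<comment> \<open>On the edge of \<open>a\<close> the value of \<open>a - b\<close> exceeds
      \<open>bound a - bound b\<close>, and on the edge of \<open>b\<close> it falls short of it, so
      the line at this integer level would separate points of the closure.\<close>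
    ultimately show False
      using normal_sign_on_closure[of "a - b" p' p "bound a - bound b"]
      by (simp add: real_vec_diff inner_diff_left)
  qed
  then have "card T \<le> card (UNIV :: (bool \<times> bool) set)"
    by (intro card_inj_on_le) auto
  then have "card (halfplane ` T) \<le> 4"
    using card_image_le[OF finT, of halfplane] by (simp add: flip: UNIV_Times_UNIV)
  moreover have "\<forall>H\<in>halfplane ` T. closed_halfplane H"
    using T closed_halfplane_halfplane by blast
  ultimately show ?thesis
    using finT closure_C_eq by (intro exI[of _ "halfplane ` T"] conjI finite_imageI)
qed

lemma bounded_closure_C: "bounded (closure C)"
proof -
  have "unit_square = cbox (0, 0) (1, 1)"
    by (simp add: unit_square_def cbox_Pair_eq)
  then show ?thesis
    using cell_subset_unit_square C_eq_cell by (metis bounded_cbox bounded_closure bounded_subset)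
qed

lemma convex_polygon_closure_C: "convex_polygon (closure C)"
  unfolding convex_polygon_def
proof (intro conjI)
  show "bounded (closure C)" by (rule bounded_closure_C)
  have "C \<subseteq> interior (closure C)"
    using open_cell C_eq_cell closure_subset interior_maximal by blast
  then show "interior (closure C) \<noteq> {}" using p0 by blast
  show "polyhedron (closure C)"
    using at_most_4_halfplanes unfolding polyhedron_def closed_halfplane_def by blast
qed

text \<open>The family with at most four half-planes shows that the minimum is attained and at most
  4. A family attaining it has a bounded nonempty intersection, hence at least three
  members.\<close>

lemma num_sides_closure_C: "num_sides (closure C) = 3 \<or> num_sides (closure C) = 4"
proof -
  define R where "R k \<longleftrightarrow>
    (\<exists>F. finite F \<and> card F = k \<and> (\<forall>H\<in>F. closed_halfplane H) \<and> closure C = \<Inter>F)" for k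
  have num: "num_sides (closure C) = Least R"
    by (simp add: num_sides_def R_def[abs_def])
  obtain k where k: "R k" "k \<le> 4" using at_most_4_halfplanes by (auto simp: R_def)
  have "R (Least R)" "Least R \<le> 4"
    using k LeastI[of R k] Least_le[of R k] by auto
  moreover have "3 \<le> k" if "R k" for k
    using that bounded_imp_3_le_card_halfplanes bounded_closure_C p0 closure_subset[of C]
    unfolding R_def by (metis empty_iff subsetD)
  ultimately show ?thesis unfolding num by fastforce
qed

end

theorem mainTheorem2:
  fixes m n :: int
  assumes "m \<ge> 1" and "n \<ge> 1"
  shows "\<forall>C \<in> components (farey_complex m n).
           is_triangle (closure C) \<or> is_quadrilateral (closure C)"
proof
  fix C assume C: "C \<in> components (farey_complex m n)"
  then obtain p0 where "p0 \<in> C" using in_components_nonempty by blast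
  then interpret farey_cell m n C p0
    using assms C by unfold_locales
  show "is_triangle (closure C) \<or> is_quadrilateral (closure C)"
    using convex_polygon_closure_C num_sides_closure_C
    by (simp add: is_triangle_def is_quadrilateral_def)
qed

end
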